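(* Let $\Sigma$ be a finite alphabet, $d\ge 1$, $n\ge 0$, and let $X=SFT(L)\subseteq\Sigma^{\mathbb{Z}^d}$ be the shift of finite type defined by a set $L\subseteq\Omega_n$. Then $\pi_n(\mathcal{I}(X))$ is a rational face of $\mathcal{I}_n$. In particular, if $X$ is uniquely ergodic and $\mu$ is the unique invariant probability measure on $X$, then $\pi_n(\mu)$ is an extreme point of $\mathcal{I}_n$.
   Context: $\Omega=\Sigma^{\mathbb{Z}^d}$ with the product topology and the shift action $(\Theta^u x)_v=x_{u+v}$ of $\mathbb{Z}^d$; $\mathcal{I}$ is the set of $\Theta$-invariant Borel probability measures on $\Omega$. $\Lambda_n=\{-n,\ldots,n\}^d$, $\Omega_n=\Sigma^{\Lambda_n}$; $\pi_n$ denotes both the restriction map $\Omega\to\Omega_n$, $x\mapsto x|_{\Lambda_n}$, and the induced push-forward map on probability measures; $\mathcal{I}_n=\pi_n(\mathcal{I})$, a closed convex subset of the real vector space $\mathbb{R}^{\Omega_n}$ (a measure $\mu$ on $\Omega_n$ is identified with the vector $(\mu(\{a\}))_{a\in\Omega_n}$). For $L\subseteq\Omega_n$, $SFT(L)=\{x\in\Omega : \pi_n(\Theta^u x)\notin L \text{ for every } u\in\mathbb{Z}^d\}$; a set of this form is a shift of finite type (SFT). $\mathcal{I}(X)\subseteq\mathcal{I}$ denotes the set of invariant probability measures supported on $X$; $X$ is uniquely ergodic if $\mathcal{I}(X)$ has exactly one element. A face of a convex set $C$ in a real vector space is the intersection of the boundary $\partial C$ with a supporting affine subspace $H$ (if a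 point of $C\cap H$ lies in the open segment between two points of $C$, then both of these points lie in $H$). The face is rational if $H$ can be chosen to be defined by affine equations with rational coefficients. For $C=\mathcal{I}_n\subseteq\mathbb{R}^{\Omega_n}$ one has $\partial C=C$. The empty set, and $C$ itself, count as faces (so the case $X=\emptyset$ is allowed). *)

theory Defs
  imports "HOL-Probability.Probability" "HOL-Library.Function_Algebras"
begin

section \<open>Function spaces as real vector spaces\<close>

instantiation "fun" :: (type, real_vector) real_vector
begin

definition scaleR_fun_def: "scaleR r f = (\<lambda>x. scaleR r (f x))"

instance
  by standard (simp_all add: scaleR_fun_def fun_eq_iff algebra_simps)

end

text \<open>
  The space of real vectors indexed by a finite set \<open>I\<close>, realised as the functions that
  vanish outside \<open>I\<close>. The topology on function types is the product topology, which on
  this subspace is the Euclidean one.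
\<close>

definition coord_space :: "'i set \<Rightarrow> ('i \<Rightarrow> real) set" where
  "coord_space I = {p. \<forall>i. i \<notin> I \<longrightarrow> p i = 0}"

section \<open>Faces\<close>

definition supporting :: "'v::real_vector set \<Rightarrow> 'v set \<Rightarrow> bool" where
  "supporting C H \<longleftrightarrow>
     affine H \<and>
     (\<forall>x \<in> C \<inter> H. \<forall>y \<in> C. \<forall>z \<in> C. x \<in> open_segment y z \<longrightarrow> y \<in> H \<and> z \<in> H)"

definition rational_subspace :: "'i set \<Rightarrow> ('i \<Rightarrow> real) set \<Rightarrow> bool" where
  "rational_subspace I H \<longleftrightarrow>
     (\<exists>E :: (('i \<Rightarrow> rat) \<times> rat) set. finite E \<and>
        H = {p \<in> coord_space I. \<forall>(c, b) \<in> E. (\<Sum>i\<in>I. of_rat (c i) * p i) = of_rat b})"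

text \<open>
  The boundary of \<open>C\<close> is its topological boundary in the space of vectors indexed by
  \<open>I\<close>, not in the whole function space (where every set supported on a finite \<open>I\<close> would
  have empty interior).
\<close>

definition rational_face :: "'i set \<Rightarrow> ('i \<Rightarrow> real) set \<Rightarrow> ('i \<Rightarrow> real) set \<Rightarrow> bool" where
  "rational_face I C F \<longleftrightarrow>
     (\<exists>H. supporting C H \<and> rational_subspace I H \<and>
          F = (top_of_set (coord_space I) frontier_of C) \<inter> H)"

section \<open>Configurations and patterns\<close>

type_synonym ('d, 'a) config = "int ^ 'd \<Rightarrow> 'a"

definition shift :: "int ^ 'd \<Rightarrow> ('d::finite, 'a) config \<Rightarrow> ('d, 'a) config" where
  "shift u x = (\<lambda>v. x (u + v))"

definition box :: "nat \<Rightarrow> (int ^ 'd::finite) set" where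
  "box n = {v. \<forall>i. - int n \<le> v $ i \<and> v $ i \<le> int n}"

text \<open>A pattern on \<open>box n\<close> is represented by its extension with value \<open>undefined\<close>.\<close>

definition patterns :: "nat \<Rightarrow> ('d::finite, 'a) config set" where
  "patterns n = box n \<rightarrow>\<^sub>E UNIV"

definition proj :: "nat \<Rightarrow> ('d::finite, 'a) config \<Rightarrow> ('d, 'a) config" where
  "proj n x = restrict x (box n)"

definition SFT :: "nat \<Rightarrow> ('d::finite, 'a) config set \<Rightarrow> ('d, 'a) config set" where
  "SFT n L = {x. \<forall>u. proj n (shift u x) \<notin> L}"

section \<open>Invariant measures\<close>

definition config_borel :: "('d::finite, 'a) config measure" where
  "config_borel =
     sigma UNIV {U. openin (product_topology (\<lambda>_. discrete_topology UNIV) UNIV) U}"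

definition invariant_measures :: "('d::finite, 'a) config measure set" where
  "invariant_measures =
     {\<mu>. prob_space \<mu> \<and> sets \<mu> = sets config_borel \<and>
         (\<forall>u. distr \<mu> config_borel (shift u) = \<mu>)}"

text \<open>For the closed (hence Borel) sets \<open>X\<close> considered here, full measure of \<open>X\<close> is the same
  as containing the topological support.\<close>

definition invariant_measures_on ::
    "('d::finite, 'a) config set \<Rightarrow> ('d, 'a) config measure set" where
  "invariant_measures_on X = {\<mu> \<in> invariant_measures. emeasure \<mu> X = 1}"

definition uniquely_ergodic :: "('d::finite, 'a) config set \<Rightarrow> bool" where
  "uniquely_ergodic X \<longleftrightarrow> (\<exists>!\<mu>. \<mu> \<in> invariant_measures_on X)"

definition marginal ::
    "nat \<Rightarrow> ('d::finite, 'a) config measure \<Rightarrow> ('d, 'a) config measure" where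
  "marginal n \<mu> = distr \<mu> (count_space (patterns n)) (proj n)"

definition marginal_vec ::
    "nat \<Rightarrow> ('d::finite, 'a) config measure \<Rightarrow> (('d, 'a) config \<Rightarrow> real)" where
  "marginal_vec n \<mu> = (\<lambda>a. measure (marginal n \<mu>) {a})"

definition invariant_marginals :: "nat \<Rightarrow> (('d::finite, 'a) config \<Rightarrow> real) set" where
  "invariant_marginals n = marginal_vec n ` invariant_measures"

end

theory Submission
  imports Defs
begin

text \<open>
  An invariant measure has full measure on \<open>SFT n L\<close> iff its marginal vanishes on \<open>L\<close>. As the
  marginals are nonnegative vectors, the equations \<open>p a = 0\<close> for \<open>a \<in> L\<close> define a supporting rational
  subspace. The boundary of the set of marginals is the set itself because it lies in the
  hyperplane of vectors with sum 1 and is compact. For compactness, an invariant measure is the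
  same thing as an invariant finitely additive probability on the algebra of clopen sets:
  compactness of the configuration space makes Caratheodory's continuity condition trivial.
\<close>

section \<open>Sets depending on finitely many coordinates, and the Borel sets they generate\<close>

text \<open>Over a finite alphabet these are, by compactness, exactly the clopen sets of the product
  topology. The finite window \<open>F\<close> makes stability under Boolean operations and shifts
  immediate.\<close>

definition clopens :: "('v \<Rightarrow> 'a) set set" where
  "clopens = {A. \<exists>F. finite F \<and> (\<forall>x y. (\<forall>v\<in>F. x v = y v) \<longrightarrow> (x \<in> A \<longleftrightarrow> y \<in> A))}"

abbreviation config_top :: "('v \<Rightarrow> 'a) topology" where
  "config_top \<equiv> product_topology (\<lambda>_. discrete_topology UNIV) UNIV"

text \<open>One implication is enough because \<open>x\<close> and \<open>y\<close> can be
  exchanged.\<close>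

lemma clopensI:
  assumes "finite F" "\<And>x y. (\<And>v. v \<in> F \<Longrightarrow> x v = y v) \<Longrightarrow> x \<in> A \<Longrightarrow> y \<in> A"
  shows "A \<in> clopens"
  unfolding clopens_def mem_Collect_eq by (rule exI[of _ F]) (metis assms)

lemma algebra_clopens: "algebra UNIV (clopens :: ('v \<Rightarrow> 'a) set set)"
  unfolding algebra_iff_Un
proof (intro conjI ballI)
  show "({} :: ('v \<Rightarrow> 'a) set) \<in> clopens"
    by (rule clopensI[of "{}"]) auto
  fix A :: "('v \<Rightarrow> 'a) set" assume "A \<in> clopens"
  then obtain F where F: "finite F" "\<And>x y. (\<forall>v\<in>F. x v = y v) \<Longrightarrow> x \<in> A \<longleftrightarrow> y \<in> A"
    unfolding clopens_def by blast
  show "UNIV - A \<in> clopens"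
    using F by (intro clopensI[of F]) blast+
  fix B :: "('v \<Rightarrow> 'a) set" assume "B \<in> clopens"
  then obtain G where G: "finite G" "\<And>x y. (\<forall>v\<in>G. x v = y v) \<Longrightarrow> x \<in> B \<longleftrightarrow> y \<in> B"
    unfolding clopens_def by blast
  show "A \<union> B \<in> clopens"
    using F(1) G(1) F(2) G(2) by (intro clopensI[of "F \<union> G"]) blast+
qed simp

text \<open>The configurations that agree with \<open>x\<close> on the window form a basic open
  neighbourhood of \<open>x\<close> inside \<open>A\<close>.\<close>

lemma clopens_openin:
  assumes "A \<in> clopens"
  shows "openin config_top A"
proof -
  obtain F where F: "finite F" "\<And>x y. (\<forall>v\<in>F. x v = y v) \<Longrightarrow> x \<in> A \<longleftrightarrow> y \<in> A"
    using assms unfolding clopens_def by blast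
  show ?thesis
    unfolding openin_product_topology_alt
  proof
    fix x assume x: "x \<in> A"
    let ?U = "\<lambda>v. if v \<in> F then {x v} else UNIV"
    have "finite {i \<in> UNIV. ?U i \<noteq> topspace (discrete_topology UNIV)}"
      by (rule finite_subset[OF _ F(1)]) auto
    moreover have "Pi\<^sub>E UNIV ?U \<subseteq> A"
    proof
      fix y assume "y \<in> Pi\<^sub>E UNIV ?U"
      then have "\<And>v. y v \<in> ?U v" by (simp add: PiE_iff)
      then have "\<forall>v\<in>F. x v = y v" by (metis singletonD)
      then show "y \<in> A" using F(2) x by blast
    qed
    ultimately show "\<exists>U. finite {i \<in> UNIV. U i \<noteq> topspace (discrete_topology UNIV)} \<and>
        (\<forall>i\<in>UNIV. openin (discrete_topology UNIV) (U i)) \<and> x \<in> Pi\<^sub>E UNIV U \<and> Pi\<^sub>E UNIV U \<subseteq> A"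
      by (intro exI[of _ ?U]) auto
  qed
qed

lemma clopens_closedin:
  assumes "A \<in> clopens"
  shows "closedin config_top A"
proof -
  have "UNIV - A \<in> clopens"
    using algebra_clopens assms unfolding algebra_iff_Un by blast
  then show ?thesis
    using clopens_openin unfolding closedin_def by simp
qed

text \<open>Countably many coordinates and a finite alphabet leave only countably many cylinders, so
  every open set is a countable union of clopen ones. Borel measures can therefore be both built and
  compared on the algebra \<open>clopens\<close>.\<close>

lemma sigma_sets_clopens:
  "sigma_sets UNIV {U. openin config_top U} =
   sigma_sets UNIV (clopens :: ('v::countable \<Rightarrow> 'a::finite) set set)"
proof (rule sigma_sets_eqI)
  fix U :: "('v \<Rightarrow> 'a) set" assume "U \<in> {U. openin config_top U}"
  then have U: "openin config_top U" by simp
  \<comment> \<open>\<open>restrict x F\<close> is \<open>undefined\<close> off \<open>F\<close>,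
    like the extensional functions in \<open>S\<close>, so for \<open>(F, f)\<close> in
    \<open>S\<close> the component \<open>f\<close> is a pattern on \<open>F\<close>.\<close>
  define cyl :: "'v set \<times> ('v \<Rightarrow> 'a) \<Rightarrow> ('v \<Rightarrow> 'a) set"
    where "cyl = (\<lambda>(F, f). {x. restrict x F = f})"
  define S where "S = (SIGMA F:{F :: 'v set. finite F}. PiE F (\<lambda>_. UNIV :: 'a set))"
  have "countable S"
    unfolding S_def
    by (intro countable_SIGMA countable_Collect_finite countable_PiE) auto
  then have "countable {A \<in> cyl ` S. A \<subseteq> U}"
    by (intro countable_subset[OF _ countable_image[of S cyl]]) auto
  moreover have "{A \<in> cyl ` S. A \<subseteq> U} \<subseteq> clopens"
  proof
    fix A assume "A \<in> {A \<in> cyl ` S. A \<subseteq> U}"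
    then obtain F f where F: "finite F" and A: "A = {x. restrict x F = f}"
      unfolding S_def cyl_def by auto
    have "restrict x F = restrict y F" if "\<And>v. v \<in> F \<Longrightarrow> x v = y v" for x y :: "'v \<Rightarrow> 'a"
      using that by (auto simp: restrict_def)
    then show "A \<in> clopens"
      unfolding A by (intro clopensI[OF F]) (metis mem_Collect_eq)
  qed
  moreover have "U = \<Union>{A \<in> cyl ` S. A \<subseteq> U}"
  proof (rule equalityI; rule subsetI)
    fix x assume "x \<in> U"
    then obtain V where V: "finite {i. V i \<noteq> UNIV}" "x \<in> Pi\<^sub>E UNIV V" "Pi\<^sub>E UNIV V \<subseteq> U"
      using U unfolding openin_product_topology_alt by auto
    \<comment> \<open>A basic neighbourhood constrains only finitely many coordinates; fixing the
      values of \<open>x\<close> there gives a cylinder inside it.\<close>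
    let ?F = "{i. V i \<noteq> UNIV}"
    have "cyl (?F, restrict x ?F) \<subseteq> U"
    proof
      fix y assume "y \<in> cyl (?F, restrict x ?F)"
      then have "\<And>i. V i \<noteq> UNIV \<Longrightarrow> y i = x i"
        by (auto simp: cyl_def restrict_def fun_eq_iff split: if_splits)
      then have "y \<in> Pi\<^sub>E UNIV V"
        using V(2) by (auto simp: PiE_iff) (metis UNIV_I)
      then show "y \<in> U" using V(3) by blast
    qed
    moreover have "(?F, restrict x ?F) \<in> S" "x \<in> cyl (?F, restrict x ?F)"
      using V(1) by (auto simp: S_def cyl_def)
    ultimately show "x \<in> \<Union>{A \<in> cyl ` S. A \<subseteq> U}" by blast
  qed auto
  ultimately show "U \<in> sigma_sets UNIV clopens"
    by (metis (no_types, lifting) sigma_sets_UNION sigma_sets.Basic subset_iff)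
qed (simp add: sigma_sets.Basic clopens_openin)

lemma sets_config_borel:
  "sets (config_borel :: ('d::finite, 'a::finite) config measure) = sigma_sets UNIV clopens"
  unfolding config_borel_def sigma_sets_clopens[symmetric] by simp

lemma space_config_borel [simp]: "space config_borel = UNIV"
  by (simp add: config_borel_def)

section \<open>Extension of finitely additive set functions to measures\<close>

text \<open>Beyond finite additivity, Caratheodory's theorem asks only for continuity at the empty
  set. By compactness a decreasing sequence of clopen sets with empty intersection is eventually
  empty, so this continuity is automatic.\<close>

lemma clopens_extend_measure:
  fixes q :: "('v::countable \<Rightarrow> 'a::finite) set \<Rightarrow> real"
  assumes nonneg: "\<And>A. A \<in> clopens \<Longrightarrow> 0 \<le> q A"
    and add: "\<And>A B. A \<in> clopens \<Longrightarrow> B \<in> clopens \<Longrightarrow> A \<inter> B = {} \<Longrightarrow> q (A \<union> B) = q A + q B"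
  obtains M where "space M = UNIV" "sets M = sigma_sets UNIV clopens"
    "\<And>A. A \<in> clopens \<Longrightarrow> emeasure M A = ennreal (q A)"
proof -
  interpret algebra UNIV "clopens :: ('v \<Rightarrow> 'a) set set" by (rule algebra_clopens)
  have q0: "q {} = 0"
    using add[of "{}" "{}"] by simp
  have "\<exists>\<mu>. (\<forall>A\<in>clopens. \<mu> A = ennreal (q A)) \<and>
          measure_space UNIV (sigma_sets UNIV (clopens :: ('v \<Rightarrow> 'a) set set)) \<mu>"
  proof (rule caratheodory_empty_continuous)
    show "positive clopens (\<lambda>A. ennreal (q A))"
      by (simp add: positive_def q0)
    show "additive clopens (\<lambda>A. ennreal (q A))"
      by (simp add: additive_def add nonneg ennreal_plus)
    fix A :: "nat \<Rightarrow> ('v \<Rightarrow> 'a) set"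
    assume A: "range A \<subseteq> clopens" "decseq A" "(\<Inter>i. A i) = {}"
    have "compact_space (config_top :: ('v \<Rightarrow> 'a) topology)"
      by (simp add: compact_space_product_topology compact_space_discrete_topology)
    \<comment> \<open>Were all \<open>A i\<close> nonempty, they would be nested nonempty closed
      sets in a compact space and would share a point.\<close>
    then obtain k where k: "A k = {}"
      using compact_space_imp_nest[of config_top A] A clopens_closedin by blast
    have "\<forall>i\<ge>k. A i = {}"
      using A(2) k by (auto simp: decseq_def)
    then have "\<forall>\<^sub>F i in sequentially. ennreal (q (A i)) = 0"
      unfolding eventually_sequentially by (intro exI[of _ k]) (simp add: q0)
    then show "(\<lambda>i. ennreal (q (A i))) \<longlonglongrightarrow> 0"
      by (rule tendsto_eventually)
  qed simp
  then obtain \<mu> where \<mu>: "\<And>A. A \<in> clopens \<Longrightarrow> \<mu> A = ennreal (q A)"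
    "measure_space UNIV (sigma_sets UNIV (clopens :: ('v \<Rightarrow> 'a) set set)) \<mu>"
    by blast
  let ?M = "measure_of UNIV (clopens :: ('v \<Rightarrow> 'a) set set) \<mu>"
  have "emeasure ?M A = ennreal (q A)" if "A \<in> clopens" for A
    using \<mu> that by (subst emeasure_measure_of_conv) (auto simp: sigma_sets.Basic)
  then show thesis
    by (intro that[of ?M]) auto
qed

section \<open>Measurability of shifts and of restrictions to a box\<close>

lemma shift_vimage_clopens:
  assumes "A \<in> clopens"
  shows "shift u -` A \<in> clopens"
proof -
  obtain F where F: "finite F" "\<And>x y. (\<forall>v\<in>F. x v = y v) \<Longrightarrow> x \<in> A \<longleftrightarrow> y \<in> A"
    using assms unfolding clopens_def by blast
  show ?thesis
  \<comment> \<open>\<open>shift u x\<close> at \<open>v\<close> reads \<open>x\<close> at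
    \<open>u + v\<close>, so the window of the preimage is \<open>F\<close> translated by
    \<open>u\<close>.\<close>
  proof (rule clopensI[of "(+) u ` F"])
    fix x y :: "('a, 'b) config"
    assume "\<And>v. v \<in> (+) u ` F \<Longrightarrow> x v = y v" "x \<in> shift u -` A"
    then show "y \<in> shift u -` A"
      using F(2)[of "shift u x" "shift u y"] by (auto simp: shift_def)
  qed (use F in auto)
qed

lemma measurable_shift:
  "shift u \<in> measurable config_borel (config_borel :: ('d::finite, 'a::finite) config measure)"
proof (rule measurable_sigma_sets[OF sets_config_borel])
  fix A :: "('d, 'a) config set" assume "A \<in> clopens"
  then show "shift u -` A \<inter> space config_borel \<in> sets config_borel"
    by (auto simp: sets_config_borel intro: sigma_sets.Basic shift_vimage_clopens)
qed auto

lemma finite_box: "finite (box n :: (int ^ 'd::finite) set)"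
proof -
  have "box n \<subseteq> vec_lambda ` (UNIV \<rightarrow>\<^sub>E {- int n..int n} :: ('d \<Rightarrow> int) set)"
  proof
    fix v :: "int ^ 'd" assume "v \<in> box n"
    then show "v \<in> vec_lambda ` (UNIV \<rightarrow>\<^sub>E {- int n..int n})"
      by (intro image_eqI[of _ _ "vec_nth v"]) (auto simp: box_def)
  qed
  then show ?thesis
    by (rule finite_subset) (intro finite_imageI finite_PiE; simp)
qed

lemma finite_patterns: "finite (patterns n :: ('d::finite, 'a::finite) config set)"
  unfolding patterns_def by (intro finite_PiE finite_box) auto

lemma proj_in_patterns [simp]: "proj n x \<in> patterns n"
  by (simp add: proj_def patterns_def)

lemma proj_vimage_clopens: "proj n -` S \<in> clopens"
proof (rule clopensI[OF finite_box[of n]])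
  fix x y :: "('a, 'b) config"
  assume "\<And>v. v \<in> box n \<Longrightarrow> x v = y v" "x \<in> proj n -` S"
  moreover from this have "proj n x = proj n y"
    by (auto simp: proj_def restrict_def)
  ultimately show "y \<in> proj n -` S" by simp
qed

section \<open>Marginals of a fixed invariant measure\<close>

context
  fixes \<mu> :: "('d::finite, 'a::finite) config measure"
  assumes \<mu>: "\<mu> \<in> invariant_measures"
begin

lemma invariant_prob: "prob_space \<mu>"
  and invariant_sets: "sets \<mu> = sets config_borel"
  and invariant_distr: "distr \<mu> config_borel (shift u) = \<mu>"
  using \<mu> by (auto simp: invariant_measures_def)

lemma invariant_space: "space \<mu> = UNIV"
  using sets_eq_imp_space_eq[OF invariant_sets] by simp

lemma clopens_measurable: "A \<in> clopens \<Longrightarrow> A \<in> sets \<mu>"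
  by (simp add: invariant_sets sets_config_borel sigma_sets.Basic)

lemma invariant_measure_shift:
  assumes "A \<in> sets \<mu>"
  shows "shift u -` A \<in> sets \<mu>" "emeasure \<mu> (shift u -` A) = emeasure \<mu> A"
proof -
  have m: "shift u \<in> measurable \<mu> config_borel"
    using measurable_shift invariant_sets measurable_cong_sets by blast
  then show "shift u -` A \<in> sets \<mu>"
    using measurable_sets[OF m] assms by (simp add: invariant_sets invariant_space)
  show "emeasure \<mu> (shift u -` A) = emeasure \<mu> A"
    using emeasure_distr[OF m, of A] assms by (simp add: invariant_sets invariant_space invariant_distr)
qed

text \<open>The value 0 off \<open>patterns n\<close> is a default: there \<open>{a}\<close> is not
  measurable in the counting space, and \<open>measure\<close> is 0 on such sets. This places the
  vector in \<open>coord_space (patterns n)\<close>.\<close>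

lemma marginal_vec_eq:
  "marginal_vec n \<mu> a = (if a \<in> patterns n then measure \<mu> (proj n -` {a}) else 0)"
proof -
  have "proj n \<in> measurable \<mu> (count_space (patterns n))"
    by (auto simp: measurable_count_space_eq2[OF finite_patterns] invariant_space
        intro: clopens_measurable proj_vimage_clopens)
  then show ?thesis
    by (auto simp: marginal_vec_def marginal_def measure_distr invariant_space
        intro!: measure_notin_sets)
qed

text \<open>The fibres of \<open>proj n\<close> partition the configuration space.\<close>

lemma marginal_vec_sum: "(\<Sum>a\<in>patterns n. marginal_vec n \<mu> a) = 1"
proof -
  interpret prob_space \<mu> by (rule invariant_prob)
  have "(\<Sum>a\<in>patterns n. marginal_vec n \<mu> a) = (\<Sum>a\<in>patterns n. measure \<mu> (proj n -` {a}))"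
    by (simp add: marginal_vec_eq)
  also have "\<dots> = measure \<mu> (\<Union>a\<in>patterns n. proj n -` {a})"
    by (rule finite_measure_finite_Union[symmetric])
      (auto simp: finite_patterns disjoint_family_on_def intro: clopens_measurable proj_vimage_clopens)
  also have "(\<Union>a\<in>patterns n. proj n -` {a}) = space \<mu>"
    by (auto simp: invariant_space)
  finally show ?thesis by (simp add: prob_space)
qed

text \<open>The complement of the SFT is the union of all translates of the cylinders given by
  \<open>L\<close>. It is a countable union, hence null iff every translate is null, and by
  invariance it suffices to test the cylinders at the origin.\<close>

lemma full_measure_SFT_iff:
  assumes "L \<subseteq> patterns n"
  shows "emeasure \<mu> (SFT n L) = 1 \<longleftrightarrow> (\<forall>a\<in>L. marginal_vec n \<mu> a = 0)"
proof -
  interpret prob_space \<mu> by (rule invariant_prob)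
  have fin: "finite L"
    using assms finite_patterns finite_subset by blast
  let ?B = "\<Union>u. \<Union>a\<in>L. shift u -` (proj n -` {a})"
  have meas: "shift u -` (proj n -` {a}) \<in> sets \<mu>" for u a
    by (intro invariant_measure_shift clopens_measurable proj_vimage_clopens)
  have SFT: "SFT n L = space \<mu> - ?B"
    by (auto simp: SFT_def invariant_space)
  have B: "?B \<in> sets \<mu>"
    using fin meas by (intro sets.countable_UN' countableI_type sets.finite_UN) auto
  have "emeasure \<mu> (SFT n L) = 1 \<longleftrightarrow> emeasure \<mu> ?B = 0"
    unfolding SFT emeasure_eq_measure using prob_compl[OF B] by (auto simp: ennreal_eq_1)
  also have "\<dots> \<longleftrightarrow> (\<forall>u. \<forall>a\<in>L. emeasure \<mu> (shift u -` (proj n -` {a})) = 0)"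
  proof
    assume "emeasure \<mu> ?B = 0"
    then show "\<forall>u. \<forall>a\<in>L. emeasure \<mu> (shift u -` (proj n -` {a})) = 0"
      by (blast intro: emeasure_eq_0[OF B])
  next
    assume "\<forall>u. \<forall>a\<in>L. emeasure \<mu> (shift u -` (proj n -` {a})) = 0"
    then have "shift u -` (proj n -` {a}) \<in> null_sets \<mu>" if "a \<in> L" for u a
      using meas that by blast
    then have "?B \<in> null_sets \<mu>"
      using fin by (intro null_sets_UN' countableI_type countable_finite) simp_all
    then show "emeasure \<mu> ?B = 0" by auto
  qed
  \<comment> \<open>All translates have the measure of the cylinder at the origin, so
    \<open>u\<close> drops out.\<close>
  also have "\<dots> \<longleftrightarrow> (\<forall>a\<in>L. emeasure \<mu> (proj n -` {a}) = 0)"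
    using invariant_measure_shift(2)[OF clopens_measurable[OF proj_vimage_clopens]] by simp
  \<comment> \<open>Since \<open>L\<close> lies in \<open>patterns n\<close>, the default branch of
    \<open>marginal_vec_eq\<close> does not occur.\<close>
  also have "\<dots> \<longleftrightarrow> (\<forall>a\<in>L. marginal_vec n \<mu> a = 0)"
    using assms by (intro ball_cong refl) (auto simp: marginal_vec_eq emeasure_eq_measure)
  finally show ?thesis .
qed

end

section \<open>Compactness of the set of marginals\<close>

text \<open>The invariant measures, encoded by their values on clopen sets: unlike the set of
  measures itself, this is visibly a closed subset of a product of compact intervals.\<close>

definition invariant_contents :: "(('d::finite, 'a) config set \<Rightarrow> real) set" where
  "invariant_contents = {q \<in> UNIV \<rightarrow>\<^sub>E {0..1}. q UNIV = 1 \<and>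
     (\<forall>A\<in>clopens. \<forall>B\<in>clopens. A \<inter> B = {} \<longrightarrow> q (A \<union> B) = q A + q B) \<and>
     (\<forall>A\<in>clopens. \<forall>u. q (shift u -` A) = q A)}"

text \<open>The cube is compact by Tychonoff's theorem, and each remaining condition is an equation
  between finitely many evaluations of \<open>q\<close>, which are continuous in the product
  topology.\<close>

lemma compact_invariant_contents: "compact (invariant_contents :: (('d::finite, 'a) config set \<Rightarrow> real) set)"
proof -
  let ?P = "UNIV \<rightarrow>\<^sub>E {0..1} :: (('d, 'a) config set \<Rightarrow> real) set"
  have "compact ?P"
    using compactin_PiE[of "\<lambda>_. euclidean" UNIV "\<lambda>_. {0..1::real}"]
    by (metis compactin_euclidean_iff compact_Icc euclidean_product_topology)
  moreover have [continuous_intros]: "continuous_on UNIV (\<lambda>q :: ('d, 'a) config set \<Rightarrow> real. q A)" for A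
    by simp
  have "closed {q :: ('d, 'a) config set \<Rightarrow> real. q UNIV = 1 \<and>
     (\<forall>A\<in>clopens. \<forall>B\<in>clopens. A \<inter> B = {} \<longrightarrow> q (A \<union> B) = q A + q B) \<and>
     (\<forall>A\<in>clopens. \<forall>u. q (shift u -` A) = q A)}"
    \<comment> \<open>The premises of the implications do not mention \<open>q\<close>, so each
      implication cuts out either the whole space or the closed set of its conclusion.\<close>
    unfolding Ball_def
    by (intro closed_Collect_conj closed_Collect_all closed_Collect_imp open_Collect_const
        closed_Collect_eq continuous_intros)
  ultimately have "compact (?P \<inter> {q :: ('d, 'a) config set \<Rightarrow> real. q UNIV = 1 \<and>
     (\<forall>A\<in>clopens. \<forall>B\<in>clopens. A \<inter> B = {} \<longrightarrow> q (A \<union> B) = q A + q B) \<and>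
     (\<forall>A\<in>clopens. \<forall>u. q (shift u -` A) = q A)})"
    by (rule compact_Int_closed)
  then show ?thesis
    by (simp add: invariant_contents_def Int_def)
qed

lemma invariant_measure_content:
  assumes "\<mu> \<in> invariant_measures"
  shows "measure \<mu> \<in> (invariant_contents :: (('d::finite, 'a::finite) config set \<Rightarrow> real) set)"
proof -
  interpret prob_space \<mu> by (rule invariant_prob[OF assms])
  have "measure \<mu> (shift u -` A) = measure \<mu> A" if "A \<in> clopens" for u A
    using invariant_measure_shift(2)[OF assms clopens_measurable[OF assms that]]
    by (simp add: measure_def)
  then show ?thesis
    using prob_space clopens_measurable[OF assms]
    by (auto simp: invariant_contents_def invariant_space[OF assms] finite_measure_Union)
qed

text \<open>The extension agrees with \<open>q\<close> on clopen sets only; elsewhere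
  \<open>q\<close> is not tied to the measure. Invariance passes from clopen to Borel sets by
  uniqueness of measures.\<close>

lemma invariant_content_measure:
  fixes q :: "('d::finite, 'a::finite) config set \<Rightarrow> real"
  assumes "q \<in> invariant_contents"
  obtains \<mu> where "\<mu> \<in> invariant_measures" "\<And>A. A \<in> clopens \<Longrightarrow> measure \<mu> A = q A"
proof -
  interpret algebra UNIV "clopens :: ('d, 'a) config set set" by (rule algebra_clopens)
  have q: "\<And>A. 0 \<le> q A" "q UNIV = 1"
    "\<And>A B. A \<in> clopens \<Longrightarrow> B \<in> clopens \<Longrightarrow> A \<inter> B = {} \<Longrightarrow> q (A \<union> B) = q A + q B"
    "\<And>A u. A \<in> clopens \<Longrightarrow> q (shift u -` A) = q A"
    using assms by (auto simp: invariant_contents_def PiE_iff)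
  obtain \<mu> where \<mu>: "space \<mu> = UNIV" "sets \<mu> = sigma_sets UNIV clopens"
    "\<And>A. A \<in> clopens \<Longrightarrow> emeasure \<mu> A = ennreal (q A)"
    using clopens_extend_measure[of q] q by metis
  have m: "shift u \<in> measurable \<mu> config_borel" for u
    using measurable_shift[of u] \<mu>(2) sets_config_borel measurable_cong_sets by metis
  have "distr \<mu> config_borel (shift u) = \<mu>" for u
  \<comment> \<open>The algebra \<open>clopens\<close> is stable under intersection and generates
    the Borel sets; the whole space, of finite measure, serves as exhausting sequence.\<close>
  proof (rule measure_eqI_generator_eq[where E = clopens and \<Omega> = UNIV and A = "\<lambda>_. UNIV"])
    show "Int_stable (clopens :: ('d, 'a) config set set)"
      by (auto simp: Int_stable_def)
    fix A :: "('d, 'a) config set" assume A: "A \<in> clopens"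
    then show "emeasure (distr \<mu> config_borel (shift u)) A = emeasure \<mu> A"
      using m by (subst emeasure_distr)
        (auto simp: \<mu> q shift_vimage_clopens sets_config_borel sigma_sets.Basic)
  qed (auto simp: \<mu> sets_config_borel q top emeasure_distr[OF m])
  moreover have "prob_space \<mu>"
    by (rule prob_spaceI) (simp add: \<mu> q top)
  ultimately have "\<mu> \<in> invariant_measures"
    by (simp add: invariant_measures_def \<mu> sets_config_borel)
  then show thesis
    by (rule that) (simp add: measure_def \<mu> q)
qed

text \<open>A marginal reads off values on cylinders only, and these are clopen. Hence the marginals
  are the image of the compact set of contents under the continuous map \<open>\<Phi>\<close>; the
  two inclusions are the two passages between measures and contents.\<close>

lemma compact_invariant_marginals:
  "compact (invariant_marginals n :: (('d::finite, 'a::finite) config \<Rightarrow> real) set)"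
proof -
  define \<Phi> where "\<Phi> = (\<lambda>(q :: ('d, 'a) config set \<Rightarrow> real) a.
    if a \<in> patterns n then q (proj n -` {a}) else 0)"
  have "continuous_on UNIV \<Phi>"
  proof (rule continuous_on_coordinatewise_then_product)
    show "continuous_on UNIV (\<lambda>q. \<Phi> q a)" for a
      by (cases "a \<in> patterns n") (simp_all add: \<Phi>_def)
  qed
  then have "compact (\<Phi> ` invariant_contents)"
    using compact_invariant_contents compact_continuous_image continuous_on_subset subset_UNIV
    by metis
  moreover have "\<Phi> ` invariant_contents = invariant_marginals n"
  proof (rule equalityI; rule subsetI)
    fix p assume "p \<in> \<Phi> ` invariant_contents"
    then obtain q where q: "q \<in> invariant_contents" "p = \<Phi> q" by blast
    obtain \<mu> where \<mu>: "\<mu> \<in> invariant_measures" "\<And>A. A \<in> clopens \<Longrightarrow> measure \<mu> A = q A"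
      using invariant_content_measure[OF q(1)] by blast
    have "p = marginal_vec n \<mu>"
      by (auto simp: fun_eq_iff marginal_vec_eq[OF \<mu>(1)] q \<Phi>_def \<mu>(2) proj_vimage_clopens)
    then show "p \<in> invariant_marginals n"
      using \<mu>(1) by (simp add: invariant_marginals_def)
  next
    fix p assume "p \<in> (invariant_marginals n :: (('d, 'a) config \<Rightarrow> real) set)"
    then obtain \<mu> where \<mu>: "\<mu> \<in> invariant_measures" "p = marginal_vec n \<mu>"
      by (auto simp: invariant_marginals_def)
    have "p = \<Phi> (measure \<mu>)"
      by (auto simp: fun_eq_iff marginal_vec_eq[OF \<mu>(1)] \<mu>(2) \<Phi>_def)
    then show "p \<in> \<Phi> ` invariant_contents"
      using invariant_measure_content[OF \<mu>(1)] by blast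
  qed
  ultimately show ?thesis by simp
qed

section \<open>The boundary of the set of marginals\<close>

text \<open>Nonnegativity will give the supporting property, the unit sum the empty
  interior.\<close>

lemma invariant_marginals_simplex:
  assumes "p \<in> (invariant_marginals n :: (('d::finite, 'a::finite) config \<Rightarrow> real) set)"
  shows "p \<in> coord_space (patterns n)" "0 \<le> p a" "(\<Sum>a\<in>patterns n. p a) = 1"
proof -
  obtain \<mu> where \<mu>: "\<mu> \<in> invariant_measures" "p = marginal_vec n \<mu>"
    using assms by (auto simp: invariant_marginals_def)
  show "p \<in> coord_space (patterns n)" "0 \<le> p a"
    by (auto simp: \<mu>(2) coord_space_def marginal_vec_eq[OF \<mu>(1)])
  show "(\<Sum>a\<in>patterns n. p a) = 1"
    by (simp add: \<mu>(2) marginal_vec_sum[OF \<mu>(1)])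
qed

text \<open>Scaling a point of \<open>C\<close> by a factor near 1 stays in the coordinate space and
  close to the point, but changes the sum, so it leaves \<open>C\<close>.\<close>

lemma interior_of_sum_eq_one:
  fixes C :: "('i \<Rightarrow> real) set"
  assumes "\<And>p. p \<in> C \<Longrightarrow> (\<Sum>i\<in>I. p i) = 1"
  shows "top_of_set (coord_space I) interior_of C = {}"
proof (rule ccontr)
  assume "top_of_set (coord_space I) interior_of C \<noteq> {}"
  then obtain p T where p: "open T" "p \<in> T" "p \<in> coord_space I" "coord_space I \<inter> T \<subseteq> C"
    unfolding interior_of_def openin_open by blast
  define g where "g = (\<lambda>(t::real) i. t * p i)"
  have "continuous_on UNIV g"
    unfolding g_def by (intro continuous_on_coordinatewise_then_product continuous_intros)
  then have "open (g -` T)"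
    using p(1) by (rule open_vimage[rotated])
  moreover have "1 \<in> g -` T"
    using p(2) by (simp add: g_def)
  ultimately obtain e where e: "e > 0" "ball 1 e \<subseteq> g -` T"
    using open_contains_ball by blast
  \<comment> \<open>Any factor in the ball other than 1 would do.\<close>
  have "1 + e / 2 \<in> ball 1 e"
    using e(1) by (simp add: dist_real_def)
  then have "g (1 + e / 2) \<in> T"
    using e(2) by blast
  moreover have "g (1 + e / 2) \<in> coord_space I"
    using p(3) by (simp add: g_def coord_space_def)
  ultimately have "(\<Sum>i\<in>I. g (1 + e / 2) i) = 1"
    using p(4) by (intro assms) blast
  then have "(1 + e / 2) * (\<Sum>i\<in>I. p i) = 1"
    by (simp add: g_def sum_distrib_left)
  moreover have "(\<Sum>i\<in>I. p i) = 1"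
    using assms p by blast
  ultimately show False using e(1) by simp
qed

text \<open>Compact sets are closed in the Hausdorff function space, so the closure is the set
  itself, and the relative interior removed from it is empty.\<close>

lemma frontier_of_invariant_marginals:
  "top_of_set (coord_space (patterns n)) frontier_of invariant_marginals n =
   (invariant_marginals n :: (('d::finite, 'a::finite) config \<Rightarrow> real) set)"
proof -
  have "closed (invariant_marginals n :: (('d, 'a) config \<Rightarrow> real) set)"
    unfolding closed_closedin
  proof (rule compactin_imp_closedin)
    show "Hausdorff_space (euclidean :: (('d, 'a) config \<Rightarrow> real) topology)"
      unfolding euclidean_product_topology[symmetric] Hausdorff_space_product_topology by simp
  qed (simp add: compact_invariant_marginals)
  then have "closedin (top_of_set (coord_space (patterns n)))
      (invariant_marginals n :: (('d, 'a) config \<Rightarrow> real) set)"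
    using invariant_marginals_simplex(1) by (intro closed_subset) auto
  then show ?thesis
    unfolding frontier_of_def
    by (simp add: closure_of_closedin interior_of_sum_eq_one invariant_marginals_simplex(3))
qed

section \<open>The supporting rational subspace\<close>

lemma rational_subspace_vanishing:
  assumes "finite I" "L \<subseteq> I"
  shows "rational_subspace I {p \<in> coord_space I. \<forall>a\<in>L. p a = 0}"
  unfolding rational_subspace_def
proof (intro exI conjI)
  \<comment> \<open>One equation per \<open>a\<close> in \<open>L\<close>: the coefficients are the
    unit vector at \<open>a\<close>, the right-hand side is 0.\<close>
  let ?E = "(\<lambda>a. ((\<lambda>i. if i = a then 1 else 0 :: rat), 0 :: rat)) ` L"
  show "finite ?E"
    using assms finite_subset by blast
  have "(\<Sum>i\<in>I. of_rat (if i = a then 1 else 0) * p i) = p a" if "a \<in> L" for a and p :: "'a \<Rightarrow> real"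
  proof -
    have "(\<Sum>i\<in>I. of_rat (if i = a then 1 else 0) * p i) = (\<Sum>i\<in>I. if i = a then p i else 0)"
      by (rule sum.cong) auto
    then show ?thesis using assms that by auto
  qed
  then show "{p \<in> coord_space I. \<forall>a\<in>L. p a = 0} =
     {p \<in> coord_space I. \<forall>(c, b)\<in>?E. (\<Sum>i\<in>I. of_rat (c i) * p i) = of_rat b}"
    by auto
qed

text \<open>A combination of two nonnegative numbers with positive weights vanishes only if both
  numbers do; this is applied at each coordinate in \<open>L\<close>.\<close>

lemma supporting_vanishing:
  fixes C :: "('i \<Rightarrow> real) set"
  assumes C: "C \<subseteq> coord_space I" "\<And>p i. p \<in> C \<Longrightarrow> 0 \<le> p i"
  shows "supporting C {p \<in> coord_space I. \<forall>a\<in>L. p a = 0}"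
  unfolding supporting_def
proof (intro conjI ballI impI)
  show "affine {p \<in> coord_space I. \<forall>a\<in>L. p a = 0}"
    by (auto simp: affine_def coord_space_def scaleR_fun_def plus_fun_def)
  fix x y z
  assume x: "x \<in> C \<inter> {p \<in> coord_space I. \<forall>a\<in>L. p a = 0}"
    and yz: "y \<in> C" "z \<in> C" and seg: "x \<in> open_segment y z"
  obtain t where t: "0 < t" "t < 1" "x = (1 - t) *\<^sub>R y + t *\<^sub>R z"
    using seg by (auto simp: in_segment)
  have "y a = 0 \<and> z a = 0" if "a \<in> L" for a
  proof -
    have "(1 - t) * y a + t * z a = 0"
      using x t(3) that by (simp add: scaleR_fun_def plus_fun_def)
    moreover have "0 \<le> (1 - t) * y a" "0 \<le> t * z a"
      using t C(2)[OF yz(1)] C(2)[OF yz(2)] by auto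
    ultimately show ?thesis
      using t by (simp add: add_nonneg_eq_0_iff)
  qed
  then show "y \<in> {p \<in> coord_space I. \<forall>a\<in>L. p a = 0}" "z \<in> {p \<in> coord_space I. \<forall>a\<in>L. p a = 0}"
    using C(1) yz by auto
qed

section \<open>The face cut out by an SFT, and its collapse to a point under unique
  ergodicity\<close>

theorem proposition5:
  fixes n :: nat
    and L :: "('d::finite, 'a::finite) config set"
  assumes "L \<subseteq> patterns n"
  shows "rational_face (patterns n) (invariant_marginals n)
           (marginal_vec n ` invariant_measures_on (SFT n L)) \<and>
         (uniquely_ergodic (SFT n L) \<longrightarrow>
           (\<forall>\<mu> \<in> invariant_measures_on (SFT n L).
              marginal_vec n \<mu> extreme_point_of (invariant_marginals n)))"
proof -
  let ?C = "invariant_marginals n :: (('d, 'a) config \<Rightarrow> real) set"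
  let ?F = "marginal_vec n ` invariant_measures_on (SFT n L)"
  let ?H = "{p \<in> coord_space (patterns n). \<forall>a\<in>L. p a = 0}"
  \<comment> \<open>Full measure on the SFT depends on the marginal alone, so selecting measures on
    the SFT amounts to intersecting the marginals with \<open>?H\<close>.\<close>
  have F: "?F = ?C \<inter> ?H"
  proof -
    have "?F = marginal_vec n ` {\<mu> \<in> invariant_measures. \<forall>a\<in>L. marginal_vec n \<mu> a = 0}"
      using full_measure_SFT_iff[OF _ assms] by (auto simp: invariant_measures_on_def intro!: imageI)
    also have "\<dots> = ?C \<inter> ?H"
      using invariant_marginals_simplex(1)[where 'd = 'd and 'a = 'a]
      by (auto simp: invariant_marginals_def)
    finally show ?thesis .
  qed
  have H: "supporting ?C ?H"
    using invariant_marginals_simplex by (intro supporting_vanishing) blast+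
  \<comment> \<open>The boundary of \<open>?C\<close> is \<open>?C\<close>, so \<open>F\<close> is
    already the required intersection.\<close>
  have "rational_face (patterns n) ?C ?F"
    unfolding rational_face_def frontier_of_invariant_marginals
    using H F rational_subspace_vanishing[OF finite_patterns assms] by blast
  moreover have "marginal_vec n \<mu> extreme_point_of ?C"
    if "uniquely_ergodic (SFT n L)" "\<mu> \<in> invariant_measures_on (SFT n L)" for \<mu>
  proof -
    have "invariant_measures_on (SFT n L) = {\<mu>}"
      using that unfolding uniquely_ergodic_def by blast
    then have single: "?C \<inter> ?H = {marginal_vec n \<mu>}"
      using F by simp
    show ?thesis
      unfolding extreme_point_of_def
    proof (intro conjI ballI notI)
      show "marginal_vec n \<mu> \<in> ?C" using single by blast
      \<comment> \<open>The supporting property puts both endpoints into the one-point face, and an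
        open segment with equal endpoints is empty.\<close>
      fix y z assume "y \<in> ?C" "z \<in> ?C" "marginal_vec n \<mu> \<in> open_segment y z"
      moreover from this have "y \<in> ?H" "z \<in> ?H"
        using H single unfolding supporting_def by blast+
      ultimately have "y = marginal_vec n \<mu>" "z = marginal_vec n \<mu>"
        using single by blast+
      then show False
        using \<open>marginal_vec n \<mu> \<in> open_segment y z\<close> by simp
    qed
  qed
  ultimately show ?thesis by blast
qed

end
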